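(* Let $n\ge2$, $p>1$, $R>0$, and let $B_R=\{x\in\mathbb{R}^n:|x|<R\}$. (i) If $p\ne n$, then $$\lambda_{p,n}(B_R)\ \ge\ \left(\frac1{pR}\right)^p\left[\frac{(n-1)^{n-1}}{(p-1)^{p-1}}\right]^{\frac{p}{n-p}} .$$ (ii) If $p=n$, then $$\lambda_{n,n}(B_R)\ \ge\ \left(\frac{n-1}{nR}\right)^n e^n .$$
   Context: $\lambda_{p,n}(\Omega)$ is the first eigenvalue of the $p$-Laplacian $\Delta_pu=\operatorname{div}(|\nabla u|^{p-2}\nabla u)$ in $\Omega\subset\mathbb{R}^n$ with zero Dirichlet boundary condition, i.e. $$\lambda_{p,n}(\Omega)=\inf_{u\in W^{1,p}_0(\Omega)\setminus\{0\}}\frac{\int_\Omega|\nabla u|^pdx}{\int_\Omega|u|^pdx}.$$ *)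

theory Defs
  imports "HOL-Analysis.Analysis"
begin

definition partial_derivative :: "'n::finite \<Rightarrow> (real^'n \<Rightarrow> real) \<Rightarrow> real^'n \<Rightarrow> real" where
  "partial_derivative i f x = frechet_derivative f (at x) (axis i 1)"

definition gradient :: "(real^'n::finite \<Rightarrow> real) \<Rightarrow> real^'n \<Rightarrow> real^'n" where
  "gradient f x = (\<chi> i. partial_derivative i f x)"

primrec C_k :: "nat \<Rightarrow> (real^'n::finite \<Rightarrow> real) \<Rightarrow> bool" where
  "C_k 0 f \<longleftrightarrow> continuous_on UNIV f"
| "C_k (Suc k) f \<longleftrightarrow>
    (\<forall>x. f differentiable (at x)) \<and> (\<forall>i. C_k k (partial_derivative i f))"

text \<open>The space of smooth functions with compact support in the open set \<open>\<Omega>\<close>; its elements are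
  regarded as functions on the whole space, extended by zero.\<close>

definition test_functions :: "(real^'n::finite) set \<Rightarrow> (real^'n \<Rightarrow> real) set" where
  "test_functions \<Omega> =
    {\<phi>. (\<forall>k. C_k k \<phi>) \<and> compact (closure {x. \<phi> x \<noteq> 0}) \<and> closure {x. \<phi> x \<noteq> 0} \<subseteq> \<Omega>}"

definition in_Lp :: "real \<Rightarrow> (real^'n::finite) set \<Rightarrow> (real^'n \<Rightarrow> 'b::euclidean_space) \<Rightarrow> bool" where
  "in_Lp p \<Omega> f \<longleftrightarrow>
    f \<in> borel_measurable (lebesgue_on \<Omega>) \<and> integrable (lebesgue_on \<Omega>) (\<lambda>x. norm (f x) powr p)"

definition locally_integrable :: "(real^'n::finite) set \<Rightarrow> (real^'n \<Rightarrow> 'b::euclidean_space) \<Rightarrow> bool" where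
  "locally_integrable \<Omega> f \<longleftrightarrow> (\<forall>K. compact K \<and> K \<subseteq> \<Omega> \<longrightarrow> integrable (lebesgue_on K) f)"

definition has_weak_gradient ::
  "(real^'n::finite) set \<Rightarrow> (real^'n \<Rightarrow> real) \<Rightarrow> (real^'n \<Rightarrow> real^'n) \<Rightarrow> bool" where
  "has_weak_gradient \<Omega> u g \<longleftrightarrow>
    locally_integrable \<Omega> u \<and> locally_integrable \<Omega> g \<and>
    (\<forall>\<phi>\<in>test_functions \<Omega>. \<forall>i.
      (LINT x|lebesgue_on \<Omega>. u x * partial_derivative i \<phi> x) =
      - (LINT x|lebesgue_on \<Omega>. g x $ i * \<phi> x))"

text \<open>Weak gradients are unique up to null sets; the choice below selects a representative.\<close>

definition weak_gradient :: "(real^'n::finite) set \<Rightarrow> (real^'n \<Rightarrow> real) \<Rightarrow> real^'n \<Rightarrow> real^'n" where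
  "weak_gradient \<Omega> u = (SOME g. has_weak_gradient \<Omega> u g)"

definition W1p :: "real \<Rightarrow> (real^'n::finite) set \<Rightarrow> (real^'n \<Rightarrow> real) set" where
  "W1p p \<Omega> =
    {u. in_Lp p \<Omega> u \<and> (\<exists>g. has_weak_gradient \<Omega> u g) \<and> in_Lp p \<Omega> (weak_gradient \<Omega> u)}"

text \<open>The closure of the test functions in the norm
  \<open>(\<integral>\<bar>u\<bar>\<^sup>p + \<integral>\<bar>\<nabla>u\<bar>\<^sup>p)\<^sup>1\<^sup>/\<^sup>p\<close> of \<open>W1p p \<Omega>\<close>. For a test function the weak gradient is the
  classical one.\<close>

definition W1p_0 :: "real \<Rightarrow> (real^'n::finite) set \<Rightarrow> (real^'n \<Rightarrow> real) set" where
  "W1p_0 p \<Omega> =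
    {u \<in> W1p p \<Omega>. \<exists>\<phi> :: nat \<Rightarrow> real^'n \<Rightarrow> real. (\<forall>k. \<phi> k \<in> test_functions \<Omega>) \<and>
      (\<lambda>k. (LINT x|lebesgue_on \<Omega>. \<bar>\<phi> k x - u x\<bar> powr p) +
           (LINT x|lebesgue_on \<Omega>. norm (gradient (\<phi> k) x - weak_gradient \<Omega> u x) powr p))
        \<longlonglongrightarrow> 0}"

text \<open>The infimum is taken in the extended reals, so it is \<open>\<infinity>\<close> over the empty set. Elements of
  \<open>W1p_0 p \<Omega>\<close> represent classes modulo null sets, hence the almost-everywhere condition for
  \<open>u \<noteq> 0\<close>.\<close>

definition first_eigenvalue :: "real \<Rightarrow> (real^'n::finite) set \<Rightarrow> ereal" where
  "first_eigenvalue p \<Omega> =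
    (INF u \<in> {u \<in> W1p_0 p \<Omega>. \<not> (AE x in lebesgue_on \<Omega>. u x = 0)}.
      ereal ((LINT x|lebesgue_on \<Omega>. norm (weak_gradient \<Omega> u x) powr p) /
             (LINT x|lebesgue_on \<Omega>. \<bar>u x\<bar> powr p)))"

end

theory Submission
  imports Defs
begin

text \<open>If a vector field \<open>V\<close> satisfies \<open>div V - (p - 1) \<bar>V\<bar> powr (p / (p - 1)) \<ge> \<lambda>\<close>, then integrating the
  divergence of \<open>\<bar>\<phi>\<bar>\<^sup>p V\<close> and applying Young's inequality to the term with \<open>\<nabla>\<phi> \<bullet> V\<close> gives
  \<open>\<lambda> \<integral>\<bar>\<phi>\<bar>\<^sup>p \<le> \<integral>\<bar>\<nabla>\<phi>\<bar>\<^sup>p\<close> for every test function \<open>\<phi>\<close>. With \<open>k = (n - 1) / (p - 1)\<close>, let \<open>\<rho>\<close> be the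
  primitive of \<open>- r powr (- k)\<close> that vanishes at \<open>R\<close>; it is \<open>p\<close>-harmonic away from the
  origin. The radial field with length \<open>((p - 1) / (p r\<^sup>k \<rho>(r))) powr (p - 1)\<close> admits as \<open>\<lambda>\<close> the minimum of
  \<open>((p - 1) / (p r\<^sup>k \<rho>(r))) powr p\<close>, the weight of a Hardy inequality that is singular both at the
  origin and at the boundary. Maximizing \<open>r\<^sup>k \<rho>(r)\<close> by Bernoulli's inequality gives
  \<open>R k powr (- (k / (k - 1)))\<close>, or \<open>R / e\<close> if \<open>k = 1\<close>.\<close>

subsection \<open>Real inequalities and derivatives\<close>

text \<open>Young's inequality for \<open>b\<close> and \<open>a powr (p - 1)\<close>, multiplied by
  \<open>p\<close>. It absorbs the term with the gradient of the test function: the loss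
  \<open>(p - 1) * a powr p\<close> is smaller by \<open>a powr p\<close> than the gain
  \<open>p * a powr p\<close> from the divergence.\<close>

lemma young_powr:
  fixes a b p :: real
  assumes "p > 1" "a \<ge> 0" "b \<ge> 0"
  shows "p * a powr (p - 1) * b \<le> b powr p + (p - 1) * a powr p"
proof -
  define q where "q = p / (p - 1)"
  have q: "q > 1" "1 / p + 1 / q = 1" "(p - 1) * q = p"
    using assms by (auto simp: q_def field_simps)
  have "b * a powr (p - 1) \<le> b powr p / p + (a powr (p - 1)) powr q / q"
    using assms q by (intro Youngs_inequality) auto
  also have "(a powr (p - 1)) powr q / q = (p - 1) * a powr p / p"
    unfolding powr_powr q(3) using assms by (simp add: q_def)
  finally show ?thesis
    using assms by (simp add: field_simps)
qed

text \<open>Convexity of the \<open>p\<close>-th power with weights \<open>1 - s\<close> and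
  \<open>s\<close>. As \<open>s\<close> tends to 0, the factor of \<open>a powr p\<close> tends to
  1, so integrals of \<open>p\<close>-th powers can be compared without taking roots.\<close>

lemma powr_add_le:
  fixes a b s p :: real
  assumes "p > 1" "a \<ge> 0" "b \<ge> 0" "0 < s" "s < 1"
  shows "(a + b) powr p \<le> (1 - s) powr (1 - p) * a powr p + s powr (1 - p) * b powr p"
proof -
  define c where "c = a + b"
  \<comment> \<open>Young's inequality for \<open>c\<close> and \<open>x / t\<close>, multiplied by
    \<open>t\<close>. Added for \<open>(a, 1 - s)\<close> and \<open>(b, s)\<close>, the left sides
    give \<open>p * c powr p\<close> and the last terms \<open>(p - 1) * c powr p\<close>, since the
    weights sum to 1.\<close>
  have *: "p * c powr (p - 1) * x \<le> t powr (1 - p) * x powr p + t * (p - 1) * c powr p"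
    if "x \<ge> 0" "t > 0" for x t
  proof -
    have "p * c powr (p - 1) * (x / t) \<le> (x / t) powr p + (p - 1) * c powr p"
      using that assms by (intro young_powr) (auto simp: c_def)
    then have "t * (p * c powr (p - 1) * (x / t)) \<le> t * ((x / t) powr p + (p - 1) * c powr p)"
      using that by (intro mult_left_mono) auto
    moreover have "t * (x / t) powr p = t powr (1 - p) * x powr p"
      using that by (simp add: powr_divide powr_diff)
    ultimately show ?thesis
      using that by (simp add: algebra_simps)
  qed
  have "c powr p = c powr (p - 1) * c"
    using assms by (cases "c = 0") (simp_all add: powr_diff c_def)
  with *[of a "1 - s"] *[of b s] assms show ?thesis
    unfolding c_def[symmetric] by (simp add: algebra_simps c_def)
qed

text \<open>The weighted inequality of arithmetic and geometric means for \<open>t\<close> and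
  1.\<close>

lemma powr_le_tangent:
  fixes k t :: real
  assumes "0 < k" "k \<le> 1" "t > 0"
  shows "t powr k \<le> 1 + k * (t - 1)"
  using Youngs_inequality_0[of k "1 - k" t 1] assms by (simp add: algebra_simps)

text \<open>The concave case with exponent \<open>1 / k\<close> at the point
  \<open>t powr k\<close>.\<close>

lemma powr_ge_tangent:
  fixes k t :: real
  assumes "k \<ge> 1" "t > 0"
  shows "t powr k \<ge> 1 + k * (t - 1)"
proof -
  have "(t powr k) powr (1 / k) \<le> 1 + (1 / k) * (t powr k - 1)"
    using assms by (intro powr_le_tangent) auto
  then show ?thesis
    using assms by (simp add: powr_powr field_simps)
qed

text \<open>At 0 the difference quotient has modulus \<open>\<bar>h\<bar> powr (p - 1)\<close>,
  which tends to 0 because \<open>p > 1\<close>; elsewhere the absolute value is locally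
  linear.\<close>

lemma has_real_derivative_abs_powr:
  fixes t p :: real
  assumes "p > 1"
  shows "((\<lambda>t. \<bar>t\<bar> powr p) has_real_derivative p * \<bar>t\<bar> powr (p - 1) * sgn t) (at t)"
proof (cases "t = 0")
  case True
  have "((\<lambda>h::real. \<bar>h\<bar> powr (p - 1)) \<longlongrightarrow> 0) (at 0)"
    using assms by (intro tendsto_eq_intros | simp)+
  moreover have "norm (\<bar>h\<bar> powr p / h) = \<bar>h\<bar> powr (p - 1)" if "h \<noteq> 0" for h
    using that by (simp add: abs_divide powr_diff)
  ultimately have "((\<lambda>h::real. norm (\<bar>h\<bar> powr p / h)) \<longlongrightarrow> 0) (at 0)"
    by (subst tendsto_cong[where g = "\<lambda>h. \<bar>h\<bar> powr (p - 1)"]) (auto simp: eventually_at_filter)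
  then have "((\<lambda>h::real. \<bar>h\<bar> powr p / h) \<longlongrightarrow> 0) (at 0)"
    by (rule tendsto_norm_zero_cancel)
  then show ?thesis
    using True by (simp add: DERIV_def)
next
  case False
  have "((\<lambda>t. (sgn u * t) powr p) has_real_derivative p * (sgn u * u) powr (p - 1) * sgn u) (at u)"
    if "u \<noteq> 0" for u :: real
    using that by (auto intro!: derivative_eq_intros simp: sgn_if)
  moreover have "\<forall>\<^sub>F x in nhds t. (sgn t * x) powr p = \<bar>x\<bar> powr p"
  proof -
    have "\<forall>\<^sub>F x in nhds t. sgn t * x > 0"
    proof (rule eventually_nhds_in_open[THEN eventually_mono])
      show "open {x. sgn t * x > 0}"
        by (intro open_Collect_less continuous_intros)
      show "t \<in> {x. sgn t * x > 0}" using False by (auto simp: sgn_if)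
    qed auto
    then show ?thesis
      by eventually_elim (auto simp: sgn_if split: if_splits)
  qed
  ultimately show ?thesis
    using False DERIV_cong_ev[OF refl, of "\<lambda>x. (sgn t * x) powr p" "\<lambda>x. \<bar>x\<bar> powr p" t]
    by (auto simp: abs_sgn mult.commute)
qed

text \<open>Squaring smooths the kink of the positive part, so a cutoff built from it is
  differentiable where it starts to grow.\<close>

lemma has_real_derivative_max_0_power2:
  "((\<lambda>t::real. (max 0 t)\<^sup>2) has_real_derivative 2 * max 0 t) (at t)"
proof -
  consider "t = 0" | "t > 0" | "t < 0" by fastforce
  then show ?thesis
  proof cases
    case 1
    have "((\<lambda>h::real. max 0 h) \<longlongrightarrow> 0) (at 0)"
      by (intro tendsto_eq_intros | simp)+
    then have "((\<lambda>h::real. (max 0 h)\<^sup>2 / h) \<longlongrightarrow> 0) (at 0)"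
      by (rule Lim_transform_eventually)
        (auto simp: eventually_at_filter max_def power2_eq_square)
    then show ?thesis using 1 by (simp add: DERIV_def)
  next
    case 2
    have "((\<lambda>t::real. t\<^sup>2) has_real_derivative 2 * t) (at t)"
      by (auto intro!: derivative_eq_intros)
    then have "((\<lambda>t::real. (max 0 t)\<^sup>2) has_real_derivative 2 * t) (at t)"
      by (rule has_field_derivative_transform_within_open[where S = "{0<..}"]) (use 2 in auto)
    then show ?thesis using 2 by simp
  next
    case 3
    have "((\<lambda>t::real. (max 0 t)\<^sup>2) has_real_derivative 0) (at t)"
      by (rule has_field_derivative_transform_within_open[where S = "{..<0}", OF DERIV_const[of 0]])
        (use 3 in auto)
    then show ?thesis using 3 by simp
  qed
qed

subsection \<open>Divergence of radial fields\<close>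

lemma lborel_integral_scaleR:
  fixes g :: "'a::euclidean_space \<Rightarrow> real"
  assumes "c > 0" and g: "g \<in> borel_measurable borel"
  shows "(LINT x|lborel. c ^ DIM('a) * g (c *\<^sub>R x)) = (LINT x|lborel. g x)"
proof -
  have "(LINT x|lborel. g x)
      = (LINT x|density (distr lborel borel (\<lambda>x. 0 + c *\<^sub>R x)) (\<lambda>_. \<bar>c\<bar>^DIM('a)). g x)"
    using lborel_affine[of c "0::'a"] assms by simp
  also have "\<dots> = (LINT x|lborel. c ^ DIM('a) * g (c *\<^sub>R x))"
    using assms by (subst integral_density) (auto simp: integral_distr)
  finally show ?thesis by simp
qed

lemma integrable_bounded_support:
  fixes f :: "'a::euclidean_space \<Rightarrow> real"
  assumes "f \<in> borel_measurable borel" "\<And>x. \<bar>f x\<bar> \<le> C" "\<And>x. norm x > r \<Longrightarrow> f x = 0"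
  shows "integrable lborel f"
proof (rule Bochner_Integration.integrable_bound)
  show "integrable lborel (\<lambda>x. C * indicator (cball (0::'a) r) x)"
    by (intro integrable_mult_right integrable_real_indicator)
      (use emeasure_lborel_cball_finite in \<open>auto simp: less_top\<close>)
  have "C \<ge> 0" using assms(2)[of 0] by linarith
  then show "AE x in lborel. norm (f x) \<le> norm (C * indicator (cball (0::'a) r) x)"
    using assms by (auto simp: indicator_def not_le)
qed (use assms in auto)

text \<open>This is the divergence theorem for the field \<open>g(x) x\<close>: by scaling, the integral of
  \<open>t\<^sup>n g(t x)\<close> over \<open>x\<close> does not depend on \<open>t\<close>, and the integrand below is its derivative at
  \<open>t = 1\<close>.\<close>


lemma integral_radial_divergence_eq_0:
  fixes g G :: "'a::euclidean_space \<Rightarrow> real"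
  assumes g: "g \<in> borel_measurable borel" and gB: "\<And>x. \<bar>g x\<bar> \<le> B"
    and supp: "\<And>x. norm x > r \<Longrightarrow> g x = 0"
    and deriv: "\<And>x. ((\<lambda>s. g (s *\<^sub>R x)) has_real_derivative G x) (at 1)"
    and GB: "\<And>x. \<bar>G x\<bar> \<le> B"
  shows "integrable lborel (\<lambda>x. real DIM('a) * g x + G x)"
    and "(LINT x|lborel. real DIM('a) * g x + G x) = 0"
proof -
  define n where "n = DIM('a)"
  \<comment> \<open>Factors above 1 keep points outside the support outside it; the bound 2 keeps
    the difference quotients uniformly bounded.\<close>
  define t where "t = (\<lambda>m::nat. 1 + 1 / real (Suc m))"
  have t: "t m > 1" "t m \<le> 2" for m by (auto simp: t_def)
  have t_lim: "t \<longlonglongrightarrow> 1"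
    unfolding t_def using tendsto_add[OF tendsto_const LIMSEQ_inverse_real_of_nat, of 1]
    by (simp add: inverse_eq_divide)
  define F where "F = (\<lambda>s x. s ^ n * g (s *\<^sub>R x))"
  have B: "B \<ge> 0" using gB[of 0] by linarith
  \<comment> \<open>The derivative along a ray is given at parameter 1 only; at \<open>s\<close> it
    comes from the ray through \<open>s *\<^sub>R x\<close>, reparametrized.\<close>
  have deriv_s: "((\<lambda>u. g (u *\<^sub>R x)) has_real_derivative G (s *\<^sub>R x) / s) (at s)" if "s > 0" for s x
  proof -
    have "((\<lambda>u. g ((u / s) *\<^sub>R (s *\<^sub>R x))) has_real_derivative G (s *\<^sub>R x) * (1 / s)) (at s)"
      by (rule DERIV_chain2[of "\<lambda>u. g (u *\<^sub>R (s *\<^sub>R x))"])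
        (use that deriv[of "s *\<^sub>R x"] in \<open>auto intro!: derivative_eq_intros\<close>)
    then show ?thesis using that by simp
  qed
  have deriv_F: "((\<lambda>u. F u x) has_real_derivative
      (real n * s ^ (n - 1) * g (s *\<^sub>R x) + s ^ n * (G (s *\<^sub>R x) / s))) (at s)" if "s > 0" for s x
    unfolding F_def by (rule derivative_eq_intros deriv_s[OF that] refl | simp)+
  define K where "K = (real n * 2 ^ n + 2 ^ n) * B"
  \<comment> \<open>The mean value theorem bounds the quotients by a constant; together with the
    bounded support this yields the dominating function \<open>w\<close>.\<close>
  have K: "\<bar>(F (t m) x - F 1 x) / (t m - 1)\<bar> \<le> K" for m x
  proof -
    define D where "D = (\<lambda>s. real n * s ^ (n - 1) * g (s *\<^sub>R x) + s ^ n * (G (s *\<^sub>R x) / s))"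
    have "\<exists>z>1. z < t m \<and> F (t m) x - F 1 x = (t m - 1) * D z"
      unfolding D_def by (intro MVT2 t(1) deriv_F) auto
    then obtain z where z: "1 < z" "z < t m" and
      eq: "F (t m) x - F 1 x = (t m - 1) * (real n * z ^ (n - 1) * g (z *\<^sub>R x) + z ^ n * (G (z *\<^sub>R x) / z))"
      by (auto simp: D_def)
    have zp: "0 \<le> z" "z \<le> 2" using z t(2)[of m] by auto
    have a: "z ^ (n - 1) \<le> 2 ^ n" "z ^ n \<le> 2 ^ n"
      using z zp by (auto intro: order_trans[OF power_mono[of z 2]] power_increasing power_mono)
    have "\<bar>real n * z ^ (n - 1) * g (z *\<^sub>R x) + z ^ n * (G (z *\<^sub>R x) / z)\<bar>
        \<le> \<bar>real n * z ^ (n - 1) * g (z *\<^sub>R x)\<bar> + \<bar>z ^ n * (G (z *\<^sub>R x) / z)\<bar>"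
      by (rule abs_triangle_ineq)
    also have "\<dots> = real n * z ^ (n - 1) * \<bar>g (z *\<^sub>R x)\<bar> + z ^ n * (\<bar>G (z *\<^sub>R x)\<bar> / z)"
      using zp by (simp add: abs_mult)
    also have "\<dots> \<le> real n * 2 ^ n * B + 2 ^ n * B"
    proof (intro add_mono mult_mono)
      have "\<bar>G (z *\<^sub>R x)\<bar> / z \<le> \<bar>G (z *\<^sub>R x)\<bar> / 1"
        using z by (intro divide_left_mono) auto
      then show "\<bar>G (z *\<^sub>R x)\<bar> / z \<le> B" using GB[of "z *\<^sub>R x"] by simp
    qed (use a gB B zp in auto)
    also have "\<dots> = K" by (simp add: K_def distrib_right)
    finally show ?thesis
      unfolding eq using t(1)[of m] by simp
  qed
  have meas_F: "F s \<in> borel_measurable borel" for s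
    unfolding F_def using g by measurable
  have lim: "(\<lambda>m. (F (t m) x - F 1 x) / (t m - 1)) \<longlonglongrightarrow> real n * g x + G x" for x
  proof -
    have "((\<lambda>u. (F u x - F 1 x) / (u - 1)) \<longlongrightarrow> real n * g x + G x) (at 1)"
      using deriv_F[of 1 x] by (simp add: has_field_derivative_iff)
    moreover have "filterlim t (at 1) sequentially"
      using t_lim t(1) by (auto simp: filterlim_at intro!: eventuallyI less_imp_neq[symmetric])
    ultimately show ?thesis by (rule filterlim_compose)
  qed
  define w where "w = (\<lambda>x::'a. K * indicator (cball (0::'a) r) x)"
  have w: "integrable lborel w"
    unfolding w_def
    by (intro integrable_mult_right integrable_real_indicator)
      (use emeasure_lborel_cball_finite in \<open>auto simp: less_top\<close>)
  have F0: "F (t m) x = 0" "F 1 x = 0" if "norm x > r" for m x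
  proof -
    have "norm x \<le> t m * norm x"
      using t(1)[of m] mult_right_mono[of 1 "t m" "norm x"] by simp
    then show "F (t m) x = 0" "F 1 x = 0" using that t(1)[of m] supp[of "t m *\<^sub>R x"] supp[of x]
      by (auto simp: F_def)
  qed
  have bound: "AE x in lborel. norm ((F (t m) x - F 1 x) / (t m - 1)) \<le> w x" for m
  proof (intro AE_I2)
    fix x
    show "norm ((F (t m) x - F 1 x) / (t m - 1)) \<le> w x"
      using K[of m x] F0(1)[of x m] F0(2)[of x] by (cases "norm x > r") (auto simp: w_def indicator_def)
  qed
  have meas: "(\<lambda>x. real n * g x + G x) \<in> borel_measurable borel"
    by (rule borel_measurable_LIMSEQ_real[OF lim]) (use meas_F in measurable)
  have meas2: "(\<lambda>x. (F (t m) x - F 1 x) / (t m - 1)) \<in> borel_measurable lborel" for m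
    using meas_F by measurable
  have meas1: "(\<lambda>x. real n * g x + G x) \<in> borel_measurable lborel"
    using meas by simp
  have lim1: "AE x in lborel. (\<lambda>m. (F (t m) x - F 1 x) / (t m - 1)) \<longlonglongrightarrow> real n * g x + G x"
    using lim by (intro AE_I2)
  show "integrable lborel (\<lambda>x. real DIM('a) * g x + G x)"
    using integrable_dominated_convergence[OF meas1 meas2 w lim1 bound] unfolding n_def .
  have "(\<lambda>m. LINT x|lborel. (F (t m) x - F 1 x) / (t m - 1)) \<longlonglongrightarrow> (LINT x|lborel. real n * g x + G x)"
    by (rule integral_dominated_convergence[OF meas1 meas2 w lim1 bound])
  \<comment> \<open>By the change of variables \<open>F (t m)\<close> and \<open>F 1\<close> have
    the same integral, so each quotient integrates to 0.\<close>
  moreover have "(LINT x|lborel. (F (t m) x - F 1 x) / (t m - 1)) = 0" for m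
  proof -
    have int_g: "integrable lborel (F 1)"
      using g gB supp by (intro integrable_bounded_support[of _ B r]) (auto simp: F_def)
    have int_F: "integrable lborel (F (t m))"
    proof (rule integrable_bounded_support[of _ "t m ^ n * B" r])
      show "\<bar>F (t m) x\<bar> \<le> t m ^ n * B" for x
        using gB[of "t m *\<^sub>R x"] t(1)[of m] by (auto simp: F_def abs_mult intro!: mult_left_mono)
    qed (use meas_F F0 in auto)
    have "(LINT x|lborel. F (t m) x) = (LINT x|lborel. F 1 x)"
      using lborel_integral_scaleR[OF _ g, of "t m"] t(1)[of m] by (simp add: F_def n_def)
    then show ?thesis
      by (simp only: integral_divide_zero Bochner_Integration.integral_diff[OF int_F int_g] diff_self div_0)
  qed
  ultimately have "(\<lambda>m::nat. 0) \<longlonglongrightarrow> (LINT x|lborel. real n * g x + G x)"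
    by (simp only:)
  then show "(LINT x|lborel. real DIM('a) * g x + G x) = 0"
    by (simp add: n_def LIMSEQ_const_iff)
qed

text \<open>The left-hand side below is the divergence of \<open>\<bar>\<phi>\<bar>\<^sup>p w \<eta> x\<close> at a point \<open>x\<close> with \<open>\<bar>x\<bar> = r\<close>,
  where \<open>Dx\<close> is the derivative of \<open>\<phi>\<close> in the direction \<open>x\<close>. The formula for \<open>w'\<close> is the derivative of
  \<open>w\<close> if \<open>\<rho>' = - (r powr (- k))\<close>.\<close>

lemma radial_divergence_ge:
  fixes r p M \<rho> N \<eta> \<eta>' \<phi> Dx d :: real
  assumes p: "p > 1" and r: "r > 0" and \<rho>: "\<rho> > 0" "r powr ((N - 1) / (p - 1)) * \<rho> \<le> M"
    and \<eta>: "0 \<le> \<eta>" "\<eta> \<le> 1" "\<eta>' \<ge> 0"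
    and Dx: "\<bar>Dx\<bar> \<le> d * r" and d: "d \<ge> 0"
  defines "c \<equiv> ((p - 1) / p) powr (p - 1)"
    and "k \<equiv> (N - 1) / (p - 1)"
  defines "w \<equiv> c * r powr (- N) * \<rho> powr (1 - p)"
    and "w' \<equiv> c * (- N * r powr (- N - 1) * \<rho> powr (1 - p)
          + r powr (- N) * ((1 - p) * \<rho> powr (- p) * - (r powr (- k))))"
  shows "N * (\<bar>\<phi>\<bar> powr p * (w * \<eta>))
      + (p * \<bar>\<phi>\<bar> powr (p - 1) * sgn \<phi> * Dx * (w * \<eta>) + \<bar>\<phi>\<bar> powr p * (r * (w' * \<eta> + w * \<eta>')))
      \<ge> ((p - 1) / (p * M)) powr p * (\<eta> * \<bar>\<phi>\<bar> powr p) - d powr p"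
proof -
  \<comment> \<open>The field \<open>w x\<close> has length
    \<open>r * w = ((p - 1) / p * Q) powr (p - 1)\<close>; \<open>a\<close> is chosen so that
    \<open>a powr (p - 1)\<close> is this length times
    \<open>\<bar>\<phi>\<bar> powr (p - 1)\<close>.\<close>
  define Q where "Q = 1 / (r powr k * \<rho>)"
  define a where "a = \<bar>\<phi>\<bar> * ((p - 1) / p) * Q"
  have M: "M > 0" using \<rho> r by (smt (verit) mult_pos_pos powr_gt_zero)
  have Q: "Q > 0" using \<rho> r by (simp add: Q_def)
  have a: "a \<ge> 0" using Q p by (simp add: a_def)
  have c: "c > 0" using p by (simp add: c_def)
  have w: "w \<ge> 0" using c by (simp add: w_def)
  have kp: "k * (p - 1) = N - 1" using p by (simp add: k_def)
  have Qp: "Q powr t = r powr (- (k * t)) * \<rho> powr (- t)" for t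
    using r \<rho> by (simp add: Q_def powr_divide powr_mult powr_powr powr_minus field_simps)
  have rw: "r * w = c * Q powr (p - 1)"
  proof -
    have "r powr (1 - N) = r * r powr (- N)"
      using r by (simp add: powr_diff powr_minus divide_simps)
    then show ?thesis unfolding w_def Qp kp by simp
  qed
  \<comment> \<open>The divergence of the field without test function and cutoff. Differentiating
    \<open>r powr (- N)\<close> cancels \<open>N * w\<close>, so only the term with the derivative
    of \<open>\<rho>\<close> survives.\<close>
  have div: "N * w + r * w' = c * (p - 1) * Q powr p"
  proof -
    have e1: "r * r powr (- N - 1) = r powr (- N)"
      using r by (simp add: powr_diff)
    have e2: "r * (r powr (- N) * r powr (- k)) = r powr (- (k * p))"
    proof -
      have "r * (r powr (- N) * r powr (- k)) = r powr (1 + (- N + - k))"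
        using r by (simp only: powr_add powr_one)
      also have "1 + (- N + - k) = - (k * p)" using kp by (simp add: algebra_simps)
      finally show ?thesis .
    qed
    have "N * w + r * w' = N * c * r powr (- N) * \<rho> powr (1 - p)
        - N * c * (r * r powr (- N - 1)) * \<rho> powr (1 - p)
        + c * (p - 1) * (r * (r powr (- N) * r powr (- k))) * \<rho> powr (- p)"
      unfolding w_def w'_def by (simp add: algebra_simps)
    then show ?thesis unfolding e1 e2 Qp by simp
  qed
  have cp: "c * (p - 1) = p * ((p - 1) / p) powr p"
    using p by (simp add: c_def powr_diff)
  have a_powr: "a powr t = \<bar>\<phi>\<bar> powr t * ((p - 1) / p) powr t * Q powr t" for t
    unfolding a_def using p Q by (simp only: powr_mult)
  have t1: "\<bar>\<phi>\<bar> powr p * (c * (p - 1) * Q powr p) = p * a powr p"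
    unfolding cp a_powr by simp
  have t2: "\<bar>\<phi>\<bar> powr (p - 1) * (c * Q powr (p - 1)) = a powr (p - 1)"
    unfolding c_def a_powr by simp
  \<comment> \<open>The bound on \<open>Dx\<close> supplies the factor \<open>r\<close> that turns
    \<open>w\<close> into the length \<open>r * w\<close>; then Young's inequality applies to
    \<open>a\<close> and \<open>d\<close>.\<close>
  have "- (p * \<bar>\<phi>\<bar> powr (p - 1) * sgn \<phi> * Dx * (w * \<eta>)) \<le> \<eta> * (p * a powr (p - 1) * d)"
  proof -
    have "\<bar>p * \<bar>\<phi>\<bar> powr (p - 1) * sgn \<phi> * Dx * (w * \<eta>)\<bar>
        = p * \<bar>\<phi>\<bar> powr (p - 1) * \<bar>sgn \<phi>\<bar> * \<bar>Dx\<bar> * (w * \<eta>)"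
      using p w \<eta> by (simp add: abs_mult)
    also have "\<dots> \<le> p * \<bar>\<phi>\<bar> powr (p - 1) * 1 * (d * r) * (w * \<eta>)"
      using p w \<eta> Dx d r by (intro mult_mono mult_nonneg_nonneg) (auto simp: sgn_if)
    also have "\<dots> = \<eta> * (p * (\<bar>\<phi>\<bar> powr (p - 1) * (r * w)) * d)"
      by (simp add: algebra_simps)
    finally show ?thesis unfolding rw t2 by linarith
  qed
  also have "\<dots> \<le> \<eta> * (d powr p + (p - 1) * a powr p)"
    using \<eta> a d p by (intro mult_left_mono young_powr) auto
  finally have A: "- (p * \<bar>\<phi>\<bar> powr (p - 1) * sgn \<phi> * Dx * (w * \<eta>)) \<le> \<eta> * (d powr p + (p - 1) * a powr p)" .
  \<comment> \<open>The term with \<open>\<eta>'\<close> is nonnegative and is dropped. Subtracting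
    the Young term leaves one \<open>a powr p\<close>.\<close>
  have "\<eta> * (p * a powr p) \<le> \<eta> * (\<bar>\<phi>\<bar> powr p * (N * w + r * w')) + \<bar>\<phi>\<bar> powr p * (r * (w * \<eta>'))"
    unfolding div t1 using w \<eta> r by simp
  with A have B: "\<eta> * a powr p - \<eta> * d powr p \<le> N * (\<bar>\<phi>\<bar> powr p * (w * \<eta>))
      + (p * \<bar>\<phi>\<bar> powr (p - 1) * sgn \<phi> * Dx * (w * \<eta>) + \<bar>\<phi>\<bar> powr p * (r * (w' * \<eta> + w * \<eta>')))"
    by (simp add: algebra_simps)
  \<comment> \<open>The bound on \<open>\<rho>\<close> says \<open>1 / M \<le> Q\<close>, which
    replaces the Hardy weight by its constant lower bound.\<close>
  have "((p - 1) / (p * M)) powr p * \<bar>\<phi>\<bar> powr p \<le> a powr p"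
  proof -
    have "1 / M \<le> Q" unfolding Q_def using \<rho> r M by (intro divide_left_mono) (auto simp: k_def)
    then have "\<bar>\<phi>\<bar> * ((p - 1) / p) * (1 / M) \<le> a"
      unfolding a_def using p by (intro mult_left_mono) auto
    then have "(\<bar>\<phi>\<bar> * ((p - 1) / p) * (1 / M)) powr p \<le> a powr p"
      using p M by (intro powr_mono2) auto
    also have "\<bar>\<phi>\<bar> * ((p - 1) / p) * (1 / M) = (p - 1) / (p * M) * \<bar>\<phi>\<bar>"
      by simp
    also have "\<dots> powr p = ((p - 1) / (p * M)) powr p * \<bar>\<phi>\<bar> powr p"
      using p M by (intro powr_mult)
    finally show ?thesis .
  qed
  then have "\<eta> * (((p - 1) / (p * M)) powr p * \<bar>\<phi>\<bar> powr p) \<le> \<eta> * a powr p"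
    using \<eta> by (intro mult_left_mono)
  moreover have "\<eta> * d powr p \<le> 1 * d powr p"
    using \<eta> by (intro mult_right_mono) auto
  ultimately show ?thesis using B by (simp add: algebra_simps)
qed

text \<open>The field is singular at the origin. The cutoff \<open>\<eta>\<close> increases with \<open>\<bar>x\<bar>\<close>, so its gradient only
  adds a nonnegative term to the divergence.\<close>

lemma hardy_cutoff:
  fixes \<phi> :: "'a::euclidean_space \<Rightarrow> real" and D :: "'a \<Rightarrow> 'a" and \<rho> :: "real \<Rightarrow> real"
    and p R M r0 \<epsilon> :: real
  defines "k \<equiv> (real DIM('a) - 1) / (p - 1)"
  assumes p: "p > 1" and r0: "0 < r0" "r0 < R" and \<epsilon>: "\<epsilon> > 0"
    and \<rho>_meas: "\<rho> \<in> borel_measurable borel"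
    and \<rho>: "\<And>r. 0 < r \<Longrightarrow> r < R \<Longrightarrow> \<rho> r > 0 \<and> r powr k * \<rho> r \<le> M"
    and \<rho>': "\<And>r. 0 < r \<Longrightarrow> r < R \<Longrightarrow> (\<rho> has_real_derivative - (r powr - k)) (at r)"
    and \<phi>': "\<And>x. (\<phi> has_derivative (\<lambda>h. D x \<bullet> h)) (at x)"
    and D_cont: "continuous_on UNIV D"
    and supp: "\<And>x. norm x > r0 \<Longrightarrow> \<phi> x = 0"
  shows "((p - 1) / (p * M)) powr p *
      (LINT x|lborel. (max 0 (norm x - \<epsilon>) / norm x)\<^sup>2 * \<bar>\<phi> x\<bar> powr p)
      \<le> (LINT x|lborel. indicator (ball 0 R) x * norm (D x) powr p)"
proof -
  define N where "N = real DIM('a)"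
  define c where "c = ((p - 1) / p) powr (p - 1)"
  \<comment> \<open>This cutoff vanishes for \<open>r \<le> \<epsilon>\<close> and tends to 1 off
    the origin as \<open>\<epsilon>\<close> tends to 0; the square makes it differentiable at
    \<open>\<epsilon>\<close>.\<close>
  define \<eta> where "\<eta> = (\<lambda>r::real. (max 0 (r - \<epsilon>) / r)\<^sup>2)"
  define \<eta>' where "\<eta>' = (\<lambda>r::real. 2 * max 0 (r - \<epsilon>) * \<epsilon> / r ^ 3)"
  define w where "w = (\<lambda>r. c * r powr (- N) * \<rho> r powr (1 - p))"
  define w' where "w' = (\<lambda>r. c * (- N * r powr (- N - 1) * \<rho> r powr (1 - p)
          + r powr (- N) * ((1 - p) * \<rho> r powr (- p) * - (r powr (- k)))))"
  define h where "h = (\<lambda>r. w r * \<eta> r)"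
  define h' where "h' = (\<lambda>r. w' r * \<eta> r + w r * \<eta>' r)"
  define g where "g = (\<lambda>x. \<bar>\<phi> x\<bar> powr p * h (norm x))"
  define G where "G = (\<lambda>x. p * \<bar>\<phi> x\<bar> powr (p - 1) * sgn (\<phi> x) * (D x \<bullet> x) * h (norm x)
      + \<bar>\<phi> x\<bar> powr p * (norm x * h' (norm x)))"

  have \<rho>_cont: "continuous_on {0<..<R} \<rho>"
    using \<rho>' by (auto intro!: continuous_at_imp_continuous_on DERIV_isCont)
  have \<eta>_deriv: "(\<eta> has_real_derivative \<eta>' r) (at r)" if "r > 0" for r
  proof -
    have "((\<lambda>r. (max 0 (r - \<epsilon>))\<^sup>2) has_real_derivative 2 * max 0 (r - \<epsilon>) * 1) (at r)"
      by (rule DERIV_chain2[OF has_real_derivative_max_0_power2])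
        (auto intro!: derivative_eq_intros)
    then have "((\<lambda>r. (max 0 (r - \<epsilon>))\<^sup>2 / r\<^sup>2) has_real_derivative
        (2 * max 0 (r - \<epsilon>) * 1 * r\<^sup>2 - (max 0 (r - \<epsilon>))\<^sup>2 * (2 * r)) / (r\<^sup>2 * r\<^sup>2)) (at r)"
      using that by (intro DERIV_divide) (auto intro!: derivative_eq_intros)
    moreover have "(2 * max 0 (r - \<epsilon>) * 1 * r\<^sup>2 - (max 0 (r - \<epsilon>))\<^sup>2 * (2 * r)) / (r\<^sup>2 * r\<^sup>2) = \<eta>' r"
      using that \<epsilon> by (cases "r \<le> \<epsilon>")
        (auto simp: \<eta>'_def max_def field_simps power2_eq_square power3_eq_cube)
    ultimately show ?thesis by (simp add: \<eta>_def power_divide)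
  qed
  have w_deriv: "(w has_real_derivative w' r) (at r)" if "0 < r" "r < R" for r
  proof -
    have a: "((\<lambda>r. r powr (- N)) has_real_derivative - N * r powr (- N - 1)) (at r)"
      using that by (auto intro!: derivative_eq_intros)
    have b: "((\<lambda>r. \<rho> r powr (1 - p)) has_real_derivative
        (1 - p) * \<rho> r powr (- p) * - (r powr (- k))) (at r)"
      using that \<rho> by (auto intro!: derivative_eq_intros \<rho>')
    show ?thesis
      unfolding w_def w'_def
      using DERIV_cmult[OF DERIV_mult[OF a b], of c] by (simp add: algebra_simps)
  qed
  have h_deriv: "(h has_real_derivative h' r) (at r)" if "0 < r" "r < R" for r
    unfolding h_def h'_def
    using DERIV_mult[OF w_deriv[OF that] \<eta>_deriv[OF that(1)]] by (simp add: algebra_simps)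
  have h_0: "h r = 0" "h' r = 0" if "r \<le> \<epsilon>" for r
    using that by (auto simp: h_def h'_def \<eta>_def \<eta>'_def)
  \<comment> \<open>Below \<open>\<epsilon>\<close> both functions vanish; on the compact interval
    from \<open>\<epsilon>\<close> to \<open>r0 < R\<close> they are continuous, since
    \<open>r\<close> and \<open>\<rho> r\<close> stay away from 0.\<close>
  obtain H where H: "\<bar>h r\<bar> \<le> H" "\<bar>h' r\<bar> \<le> H" if "0 \<le> r" "r \<le> r0" for r
  proof -
    have nz: "\<rho> r \<noteq> 0" "r \<noteq> 0" if "r \<in> {\<epsilon>..r0}" for r
      using \<rho>[of r] \<epsilon> r0 that by auto
    have \<rho>_c: "continuous_on {\<epsilon>..r0} \<rho>"
      by (rule continuous_on_subset[OF \<rho>_cont]) (use \<epsilon> r0 in auto)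
    have "continuous_on {\<epsilon>..r0} h" "continuous_on {\<epsilon>..r0} h'"
      unfolding h_def h'_def w_def w'_def \<eta>_def \<eta>'_def
      by (intro continuous_intros \<rho>_c; use nz in force)+
    then have "bounded (h ` {\<epsilon>..r0})" "bounded (h' ` {\<epsilon>..r0})"
      by (auto intro!: compact_imp_bounded compact_continuous_image)
    then obtain H1 H2 where "\<forall>r\<in>{\<epsilon>..r0}. \<bar>h r\<bar> \<le> H1" "\<forall>r\<in>{\<epsilon>..r0}. \<bar>h' r\<bar> \<le> H2"
      unfolding bounded_iff by auto
    then have "\<bar>h r\<bar> \<le> max 0 (max H1 H2) \<and> \<bar>h' r\<bar> \<le> max 0 (max H1 H2)" if "r \<le> r0" for r
      using h_0[of r] that by (cases "r \<le> \<epsilon>") (auto simp: le_max_iff_disj)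
    then show ?thesis using that by blast
  qed
  have \<phi>_cont: "continuous_on S \<phi>" for S
    using \<phi>' by (intro continuous_at_imp_continuous_on ballI has_derivative_continuous) auto
  obtain B where B: "\<bar>\<phi> x\<bar> \<le> B" "norm (D x) \<le> B" if "norm x \<le> r0" for x
  proof -
    have "bounded (\<phi> ` cball 0 r0)" "bounded (D ` cball 0 r0)"
      using \<phi>_cont continuous_on_subset[OF D_cont]
      by (auto intro!: compact_imp_bounded compact_continuous_image)
    then obtain B1 B2 where "\<forall>x\<in>cball 0 r0. \<bar>\<phi> x\<bar> \<le> B1" "\<forall>x\<in>cball 0 r0. norm (D x) \<le> B2"
      unfolding bounded_iff by auto
    then have "\<bar>\<phi> x\<bar> \<le> max B1 B2" "norm (D x) \<le> max B1 B2" if "norm x \<le> r0" for x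
      using that by (auto simp: le_max_iff_disj)
    then show ?thesis using that by blast
  qed
  have B0: "B \<ge> 0" using B(1)[of 0] r0 by auto
  have H0: "H \<ge> 0" using H(1)[of 0] r0 by auto
  have \<phi>p: "\<bar>\<phi> x\<bar> powr t \<le> B powr t" if "t > 0" for x t
    using B(1)[of x] supp[of x] that by (cases "norm x \<le> r0") (auto intro!: powr_mono2)
  have w_meas: "w \<in> borel_measurable borel"
    unfolding w_def using \<rho>_meas by measurable
  have \<eta>_meas: "\<eta> \<in> borel_measurable borel"
    unfolding \<eta>_def by measurable
  have h_meas: "h \<in> borel_measurable borel"
    unfolding h_def using w_meas \<eta>_meas by measurable
  have \<phi>_meas: "\<phi> \<in> borel_measurable borel"
    by (intro borel_measurable_continuous_onI \<phi>_cont)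
  have D_meas: "D \<in> borel_measurable borel"
    by (intro borel_measurable_continuous_onI D_cont)
  have g_meas: "g \<in> borel_measurable borel"
    unfolding g_def using \<phi>_meas h_meas by measurable
  have g_B: "\<bar>g x\<bar> \<le> B powr p * H" for x
  proof (cases "norm x \<le> r0")
    case True
    then show ?thesis
      unfolding g_def abs_mult using \<phi>p[of p x] H(1)[of "norm x"] p by (intro mult_mono) auto
  qed (use supp[of x] H0 in \<open>auto simp: g_def\<close>)
  have G_B: "\<bar>G x\<bar> \<le> p * B powr (p - 1) * 1 * (B * r0) * H + B powr p * (r0 * H)" for x
  proof (cases "norm x \<le> r0")
    case True
    have "\<bar>D x \<bullet> x\<bar> \<le> norm (D x) * norm x"
      by (rule Cauchy_Schwarz_ineq2)
    also have "\<dots> \<le> B * r0"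
      using B(2)[OF True] True B0 by (intro mult_mono) auto
    finally have Dx: "\<bar>D x \<bullet> x\<bar> \<le> B * r0" .
    have "\<bar>G x\<bar> \<le> \<bar>p * \<bar>\<phi> x\<bar> powr (p - 1) * sgn (\<phi> x) * (D x \<bullet> x) * h (norm x)\<bar>
        + \<bar>\<bar>\<phi> x\<bar> powr p * (norm x * h' (norm x))\<bar>"
      unfolding G_def by (rule abs_triangle_ineq)
    also have "\<dots> = p * \<bar>\<phi> x\<bar> powr (p - 1) * \<bar>sgn (\<phi> x)\<bar> * \<bar>D x \<bullet> x\<bar> * \<bar>h (norm x)\<bar>
        + \<bar>\<phi> x\<bar> powr p * (norm x * \<bar>h' (norm x)\<bar>)"
      using p by (simp add: abs_mult)
    also have "\<dots> \<le> p * B powr (p - 1) * 1 * (B * r0) * H + B powr p * (r0 * H)"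
      using \<phi>p[of p x] \<phi>p[of "p - 1" x] H[of "norm x"] p Dx True r0 B0 H0
      by (intro add_mono mult_mono) (auto simp: sgn_if)
    finally show ?thesis .
  qed (use supp[of x] H0 B0 r0 p in \<open>auto simp: G_def\<close>)
  \<comment> \<open>The chain rule needs \<open>0 < norm x < R\<close>. At the origin the ray is
    constant, and beyond \<open>r0\<close> the function vanishes near the point.\<close>
  have g_deriv: "((\<lambda>s. g (s *\<^sub>R x)) has_real_derivative G x) (at 1)" for x
  proof -
    consider "x = 0" | "norm x > r0" | "0 < norm x" "norm x \<le> r0" by fastforce
    then show ?thesis
    proof cases
      case 1
      then show ?thesis by (simp add: G_def)
    next
      case 2
      have "open {s. norm (s *\<^sub>R x) > r0}"
        by (intro open_Collect_less continuous_intros)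
      then have "((\<lambda>s. g (s *\<^sub>R x)) has_real_derivative 0) (at 1)"
        by (rule has_field_derivative_transform_within_open[OF DERIV_const[of 0]])
          (use 2 supp in \<open>auto simp: g_def simp del: norm_scaleR\<close>)
      then show ?thesis using supp[OF 2] by (simp add: G_def)
    next
      case 3
      have "((\<lambda>s. \<phi> (s *\<^sub>R x)) has_derivative (\<lambda>s. D (1 *\<^sub>R x) \<bullet> (s *\<^sub>R x))) (at 1)"
        by (rule has_derivative_compose[of "\<lambda>s. s *\<^sub>R x", OF _ \<phi>'])
          (auto intro!: derivative_eq_intros)
      then have "((\<lambda>s. \<phi> (s *\<^sub>R x)) has_real_derivative (D x \<bullet> x)) (at 1)"
        by (simp add: has_field_derivative_def mult_commute_abs)
      then have 1: "((\<lambda>s. \<bar>\<phi> (s *\<^sub>R x)\<bar> powr p) has_real_derivative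
          p * \<bar>\<phi> x\<bar> powr (p - 1) * sgn (\<phi> x) * (D x \<bullet> x)) (at 1)"
        using DERIV_chain2[of "\<lambda>t. \<bar>t\<bar> powr p" _ "\<lambda>s. \<phi> (s *\<^sub>R x)" 1]
          has_real_derivative_abs_powr[OF p, of "\<phi> x"] by simp
      have "((\<lambda>s. h (s * norm x)) has_real_derivative h' (norm x) * norm x) (at 1)"
        by (rule DERIV_chain2[of h]) (use h_deriv[of "norm x"] 3 r0 in \<open>auto intro!: derivative_eq_intros\<close>)
      then have 2: "((\<lambda>s. h (norm (s *\<^sub>R x))) has_real_derivative h' (norm x) * norm x) (at 1)"
        by (rule has_field_derivative_transform_within_open[where S = "{0<..}"]) auto
      show ?thesis
        unfolding g_def G_def using DERIV_mult[OF 1 2] by (simp add: algebra_simps)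
    qed
  qed
  define C where "C = max (B powr p * H) (p * B powr (p - 1) * 1 * (B * r0) * H + B powr p * (r0 * H))"
  have supp_g: "g x = 0" if "norm x > r0" for x
    using supp[OF that] by (simp add: g_def)
  have int0: "integrable lborel (\<lambda>x. N * g x + G x)" "(LINT x|lborel. N * g x + G x) = 0"
    unfolding N_def
    by (rule integral_radial_divergence_eq_0[OF g_meas _ supp_g g_deriv, of C];
        use g_B G_B in \<open>auto simp: C_def le_max_iff_disj\<close>)+

  define \<Lambda> where "\<Lambda> = ((p - 1) / (p * M)) powr p"
  have le: "\<Lambda> * (\<eta> (norm x) * \<bar>\<phi> x\<bar> powr p) - indicator (ball 0 R) x * norm (D x) powr p
      \<le> N * g x + G x" for x
  proof -
    consider "x = 0" | "norm x > r0" | "0 < norm x" "norm x \<le> r0" by fastforce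
    then show ?thesis
    proof cases
      \<comment> \<open>Here division by zero makes \<open>\<eta>\<close> equal to 0 and the right
        side vanishes, so only a nonpositive left side remains.\<close>
      case 1
      then show ?thesis by (simp add: g_def G_def \<eta>_def h_def indicator_def)
    next
      case 2
      then show ?thesis using supp[OF 2] by (simp add: g_def G_def)
    next
      case 3
      have \<eta>_b: "0 \<le> \<eta> (norm x)" "\<eta> (norm x) \<le> 1" "0 \<le> \<eta>' (norm x)"
        using 3 \<epsilon> by (auto simp: \<eta>_def \<eta>'_def max_def intro!: power_le_one)
      show ?thesis
        using radial_divergence_ge[of p "norm x" "\<rho> (norm x)" N M "\<eta> (norm x)" "\<eta>' (norm x)" "D x \<bullet> x"
            "norm (D x)" "\<phi> x"] \<rho>[of "norm x"] p 3 r0 \<eta>_b Cauchy_Schwarz_ineq2[of "D x" x]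
        by (simp add: g_def G_def h_def h'_def w_def w'_def c_def k_def N_def \<Lambda>_def)
    qed
  qed
  have \<eta>_le: "\<eta> r \<le> 1" "\<eta> r \<ge> 0" if "r \<ge> 0" for r
    using that \<epsilon> by (auto simp: \<eta>_def max_def divide_le_eq intro!: power_le_one)
  have int1: "integrable lborel (\<lambda>x. \<eta> (norm x) * \<bar>\<phi> x\<bar> powr p)"
  proof (rule integrable_bounded_support[of _ "1 * B powr p" r0])
    show "(\<lambda>x. \<eta> (norm x) * \<bar>\<phi> x\<bar> powr p) \<in> borel_measurable borel"
      using \<eta>_meas \<phi>_meas by measurable
    show "\<bar>\<eta> (norm x) * \<bar>\<phi> x\<bar> powr p\<bar> \<le> 1 * B powr p" for x
      unfolding abs_mult using \<phi>p[of p x] p \<eta>_le[of "norm x"] by (intro mult_mono) auto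
  qed (use supp in auto)
  \<comment> \<open>Only continuity of \<open>D\<close> is at hand, so the indicator confines the
    integral to a bounded set.\<close>
  have int2: "integrable lborel (\<lambda>x. indicator (ball 0 R) x * norm (D x) powr p)"
  proof -
    have "bounded (D ` cball 0 R)"
      using continuous_on_subset[OF D_cont] by (auto intro!: compact_imp_bounded compact_continuous_image)
    then obtain B' where B': "\<forall>x\<in>cball 0 R. norm (D x) \<le> B'"
      unfolding bounded_iff by auto
    have "norm (D x) powr p \<le> B' powr p" if "norm x < R" for x
      using B' that p by (intro powr_mono2) auto
    then show ?thesis
      using D_meas by (intro integrable_bounded_support[of _ "B' powr p" R]) (auto simp: indicator_def)
  qed
  have "(LINT x|lborel. \<Lambda> * (\<eta> (norm x) * \<bar>\<phi> x\<bar> powr p) - indicator (ball 0 R) x * norm (D x) powr p) \<le> 0"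
    unfolding int0(2)[symmetric] using int0(1) int1 int2 le by (intro integral_mono) auto
  then show ?thesis
    using int1 int2 by (simp add: \<Lambda>_def \<eta>_def)
qed

subsection \<open>Test functions on a ball\<close>

lemma gradient_has_derivative:
  assumes "f differentiable (at x)"
  shows "(f has_derivative (\<lambda>h. gradient f x \<bullet> h)) (at x)"
proof -
  let ?f' = "frechet_derivative f (at x)"
  have f': "(f has_derivative ?f') (at x)"
    using assms by (simp add: frechet_derivative_works)
  then interpret bounded_linear ?f' by (rule has_derivative_bounded_linear)
  have "?f' = (\<lambda>h. gradient f x \<bullet> h)"
  proof
    fix h
    have "?f' h = ?f' (\<Sum>i\<in>UNIV. (h $ i) *\<^sub>R axis i 1)"
      using basis_expansion[of h] by (simp add: scalar_mult_eq_scaleR)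
    also have "\<dots> = gradient f x \<bullet> h"
      by (simp add: sum scaleR gradient_def partial_derivative_def inner_vec_def mult.commute)
    finally show "?f' h = gradient f x \<bullet> h" .
  qed
  with f' show ?thesis by (simp only:)
qed

lemma test_function_smooth:
  assumes "\<phi> \<in> test_functions \<Omega>"
  shows "(\<phi> has_derivative (\<lambda>h. gradient \<phi> x \<bullet> h)) (at x)" "continuous_on UNIV (gradient \<phi>)"
proof -
  have "C_k (Suc 0) \<phi>" using assms unfolding test_functions_def by blast
  then show "(\<phi> has_derivative (\<lambda>h. gradient \<phi> x \<bullet> h)) (at x)"
    by (intro gradient_has_derivative) auto
  show "continuous_on UNIV (gradient \<phi>)"
    unfolding gradient_def[abs_def] using \<open>C_k (Suc 0) \<phi>\<close>
    by (intro continuous_on_vec_lambda) auto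
qed

text \<open>On the compact closed support the norm attains a maximum, which is below
  \<open>R\<close>; the maximum with \<open>R / 2\<close> keeps the radius positive.\<close>

lemma test_function_ball_support:
  assumes \<phi>: "\<phi> \<in> test_functions (ball 0 R)" and "R > 0"
  obtains r where "0 < r" "r < R" "\<And>x. norm x > r \<Longrightarrow> \<phi> x = 0"
proof (cases "closure {x. \<phi> x \<noteq> 0} = {}")
  case True
  then have "\<phi> x = 0" for x by auto
  then show ?thesis using that[of "R / 2"] assms by auto
next
  case False
  have "compact (closure {x. \<phi> x \<noteq> 0})" "closure {x. \<phi> x \<noteq> 0} \<subseteq> ball 0 R"
    using \<phi> by (auto simp: test_functions_def)
  then obtain y where y: "y \<in> closure {x. \<phi> x \<noteq> 0}" "\<And>x. x \<in> closure {x. \<phi> x \<noteq> 0} \<Longrightarrow> norm x \<le> norm y"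
    using continuous_attains_sup[of "closure {x. \<phi> x \<noteq> 0}" norm] False continuous_on_norm_id by metis
  have "norm y < R" using y \<open>_ \<subseteq> ball 0 R\<close> by auto
  moreover have "\<phi> x = 0" if "norm x > max (R / 2) (norm y)" for x
    using y(2)[of x] closure_subset[of "{x. \<phi> x \<noteq> 0}"] that by auto
  ultimately show ?thesis using that[of "max (R / 2) (norm y)"] assms by auto
qed

text \<open>Links the Lebesgue integrals in the Rayleigh quotient to the \<open>lborel\<close>
  integrals over the whole space used in the divergence argument.\<close>

lemma ball_integral_eq:
  fixes f :: "real^'n::finite \<Rightarrow> real"
  assumes "f \<in> borel_measurable borel"
  shows "(LINT x|lebesgue_on (ball a R). f x) = (LINT x|lborel. indicator (ball a R) x * f x)"
proof -
  have "(LINT x|lebesgue_on (ball a R). f x) = (LINT x|lebesgue. indicator (ball a R) x *\<^sub>R f x)"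
    by (intro integral_restrict_space) auto
  also have "\<dots> = (LINT x|lborel. indicator (ball a R) x *\<^sub>R f x)"
  proof (rule integral_completion)
    have [measurable]: "ball a R \<in> sets borel" by simp
    show "(\<lambda>x. indicator (ball a R) x *\<^sub>R f x) \<in> borel_measurable lborel"
      using assms by measurable
  qed
  finally show ?thesis by simp
qed

lemma continuous_integrable_ball:
  fixes f :: "real^'n::finite \<Rightarrow> real"
  assumes f: "continuous_on UNIV f"
  shows "integrable (lebesgue_on (ball a R)) f"
proof -
  have "bounded (f ` cball a R)"
    using continuous_on_subset[OF f, of "cball a R"] by (auto intro!: compact_imp_bounded compact_continuous_image)
  then obtain B where B: "\<forall>x\<in>cball a R. \<bar>f x\<bar> \<le> B"
    unfolding bounded_iff by auto
  have [measurable]: "ball a R \<in> sets borel" by simp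
  have meas: "(\<lambda>x. indicator (ball a R) x *\<^sub>R f x) \<in> borel_measurable borel"
    using borel_measurable_continuous_onI[OF f] by measurable
  have "integrable lborel (\<lambda>x. indicator (ball a R) x *\<^sub>R f x)"
  proof (rule integrable_bounded_support[of _ "max 0 B" "norm a + R", OF meas])
    show "\<bar>indicator (ball a R) x *\<^sub>R f x\<bar> \<le> max 0 B" for x
      using B by (auto simp: indicator_def le_max_iff_disj)
    show "indicator (ball a R) x *\<^sub>R f x = 0" if "norm x > norm a + R" for x
      using that norm_triangle_ineq2[of x a] by (auto simp: indicator_def dist_norm norm_minus_commute)
  qed
  then show ?thesis
    using meas by (simp add: integrable_restrict_space integrable_completion)
qed

text \<open>Removes the cutoff: its factor tends to 1 off the origin as \<open>\<epsilon>\<close>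
  tends to 0, \<open>\<bar>\<phi>\<bar> powr p\<close> dominates, and the gradient side does not
  depend on \<open>\<epsilon>\<close>.\<close>

lemma hardy_test_function:
  fixes \<phi> :: "real^'n::finite \<Rightarrow> real" and p R M :: real and \<rho> :: "real \<Rightarrow> real"
  defines "k \<equiv> (real CARD('n) - 1) / (p - 1)"
  assumes p: "p > 1" and R: "R > 0" and \<phi>: "\<phi> \<in> test_functions (ball 0 R)"
    and \<rho>_meas: "\<rho> \<in> borel_measurable borel"
    and \<rho>: "\<And>r. 0 < r \<Longrightarrow> r < R \<Longrightarrow> \<rho> r > 0 \<and> r powr k * \<rho> r \<le> M"
    and \<rho>': "\<And>r. 0 < r \<Longrightarrow> r < R \<Longrightarrow> (\<rho> has_real_derivative - (r powr - k)) (at r)"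
  shows "((p - 1) / (p * M)) powr p * (LINT x|lebesgue_on (ball 0 R). \<bar>\<phi> x\<bar> powr p)
      \<le> (LINT x|lebesgue_on (ball 0 R). norm (gradient \<phi> x) powr p)"
proof -
  obtain r0 where r0: "0 < r0" "r0 < R" and supp: "\<And>x. norm x > r0 \<Longrightarrow> \<phi> x = 0"
    using test_function_ball_support[OF \<phi> R] by blast
  note smooth = test_function_smooth[OF \<phi>]
  have \<phi>_cont: "continuous_on S \<phi>" for S
    using smooth(1) by (intro continuous_at_imp_continuous_on ballI has_derivative_continuous) auto
  have \<phi>_meas [measurable]: "\<phi> \<in> borel_measurable borel"
    by (intro borel_measurable_continuous_onI \<phi>_cont)
  have D_meas [measurable]: "gradient \<phi> \<in> borel_measurable borel"
    by (intro borel_measurable_continuous_onI smooth(2))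
  define \<epsilon> where "\<epsilon> = (\<lambda>m. 1 / real (Suc m))"
  define f where "f = (\<lambda>m x. (max 0 (norm x - \<epsilon> m) / norm x)\<^sup>2 * \<bar>\<phi> x\<bar> powr p)"
  have \<epsilon>: "\<epsilon> m > 0" for m by (simp add: \<epsilon>_def)
  have \<epsilon>_lim: "\<epsilon> \<longlonglongrightarrow> 0"
    using LIMSEQ_inverse_real_of_nat by (simp add: \<epsilon>_def inverse_eq_divide)
  have "bounded (\<phi> ` cball 0 r0)"
    using \<phi>_cont by (auto intro!: compact_imp_bounded compact_continuous_image)
  then obtain B where B: "\<forall>x\<in>cball 0 r0. \<bar>\<phi> x\<bar> \<le> B"
    unfolding bounded_iff by auto
  have int: "integrable lborel (\<lambda>x. \<bar>\<phi> x\<bar> powr p)"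
  proof (rule integrable_bounded_support[of _ "B powr p" r0])
    show "\<bar>\<bar>\<phi> x\<bar> powr p\<bar> \<le> B powr p" for x
      using B p supp[of x] by (cases "norm x \<le> r0") (auto intro!: powr_mono2)
  qed (use supp in auto)
  have "(\<lambda>m. integral\<^sup>L lborel (f m)) \<longlonglongrightarrow> (LINT x|lborel. \<bar>\<phi> x\<bar> powr p)"
  proof (rule integral_dominated_convergence[OF _ _ int])
    show "f m \<in> borel_measurable lborel" for m
      unfolding f_def by measurable
    show "AE x in lborel. norm (f m x) \<le> \<bar>\<phi> x\<bar> powr p" for m
    proof (intro AE_I2)
      fix x :: "real^'n"
      have "(max 0 (norm x - \<epsilon> m) / norm x)\<^sup>2 \<le> 1"
        using \<epsilon>[of m] by (intro power_le_one) (auto simp: max_def divide_le_eq)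
      then have "(max 0 (norm x - \<epsilon> m) / norm x)\<^sup>2 * \<bar>\<phi> x\<bar> powr p \<le> 1 * \<bar>\<phi> x\<bar> powr p"
        by (intro mult_right_mono) auto
      then show "norm (f m x) \<le> \<bar>\<phi> x\<bar> powr p"
        by (simp add: f_def)
    qed
    show "AE x in lborel. (\<lambda>m. f m x) \<longlonglongrightarrow> \<bar>\<phi> x\<bar> powr p"
      \<comment> \<open>At the origin the factor is 0 for every \<open>m\<close>, so convergence is
        claimed outside this null set only.\<close>
      using AE_lborel_singleton[of 0]
    proof eventually_elim
      case (elim x)
      have "(\<lambda>m. f m x) \<longlonglongrightarrow> (max 0 (norm x - 0) / norm x)\<^sup>2 * \<bar>\<phi> x\<bar> powr p"
        unfolding f_def using elim by (intro tendsto_intros \<epsilon>_lim) auto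
      then show ?case using elim by simp
    qed
  qed auto
  then have "(\<lambda>m. ((p - 1) / (p * M)) powr p * integral\<^sup>L lborel (f m))
      \<longlonglongrightarrow> ((p - 1) / (p * M)) powr p * (LINT x|lborel. \<bar>\<phi> x\<bar> powr p)"
    by (intro tendsto_intros)
  moreover have "((p - 1) / (p * M)) powr p * integral\<^sup>L lborel (f m)
      \<le> (LINT x|lborel. indicator (ball 0 R) x * norm (gradient \<phi> x) powr p)" for m
    unfolding f_def using p r0 \<epsilon> \<rho>_meas \<rho> \<rho>' smooth supp
    by (intro hardy_cutoff) (auto simp: k_def)
  ultimately have "((p - 1) / (p * M)) powr p * (LINT x|lborel. \<bar>\<phi> x\<bar> powr p)
      \<le> (LINT x|lborel. indicator (ball 0 R) x * norm (gradient \<phi> x) powr p)"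
    by (intro LIMSEQ_le_const2) auto
  moreover have "(LINT x|lebesgue_on (ball 0 R). \<bar>\<phi> x\<bar> powr p) = (LINT x|lborel. \<bar>\<phi> x\<bar> powr p)"
  proof -
    have eq: "(\<lambda>x. indicator (ball 0 R) x * \<bar>\<phi> x\<bar> powr p) = (\<lambda>x. \<bar>\<phi> x\<bar> powr p)"
      using supp r0 by (auto simp: indicator_def fun_eq_iff)
    have meas: "(\<lambda>x. \<bar>\<phi> x\<bar> powr p) \<in> borel_measurable borel" by measurable
    show ?thesis by (simp only: ball_integral_eq[OF meas] eq)
  qed
  moreover have "(LINT x|lebesgue_on (ball 0 R). norm (gradient \<phi> x) powr p)
      = (LINT x|lborel. indicator (ball 0 R) x * norm (gradient \<phi> x) powr p)"
    by (rule ball_integral_eq) measurable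
  ultimately show ?thesis by simp
qed

subsection \<open>Passage to Sobolev functions\<close>

text \<open>A substitute for Minkowski's inequality: \<open>powr_add_le\<close> is applied pointwise
  to \<open>f = g + (f - g)\<close>.\<close>

lemma integral_norm_powr_le:
  fixes f g :: "'a \<Rightarrow> 'b::euclidean_space"
  assumes p: "p > 1" and s: "0 < s" "s < 1"
    and f: "f \<in> borel_measurable M" "integrable M (\<lambda>x. norm (f x) powr p)"
    and g: "g \<in> borel_measurable M" "integrable M (\<lambda>x. norm (g x) powr p)"
  shows "(LINT x|M. norm (f x) powr p)
      \<le> (1 - s) powr (1 - p) * (LINT x|M. norm (g x) powr p)
        + s powr (1 - p) * (LINT x|M. norm (f x - g x) powr p)"
proof -
  \<comment> \<open>Needed because a non-integrable function has Bochner integral 0 by convention.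
    Convexity with both weights \<open>1 / 2\<close> gives the dominating function.\<close>
  have "integrable M (\<lambda>x. norm (f x - g x) powr p)"
  proof (rule Bochner_Integration.integrable_bound)
    show "integrable M (\<lambda>x. (1 / 2) powr (1 - p) * norm (f x) powr p + (1 / 2) powr (1 - p) * norm (g x) powr p)"
      using f g by simp
    show "AE x in M. norm (norm (f x - g x) powr p)
        \<le> norm ((1 / 2) powr (1 - p) * norm (f x) powr p + (1 / 2) powr (1 - p) * norm (g x) powr p)"
    proof (intro AE_I2)
      fix x
      have "norm (f x - g x) powr p \<le> (norm (f x) + norm (g x)) powr p"
        using p by (intro powr_mono2 norm_triangle_ineq4) auto
      also have "\<dots> \<le> (1 - 1 / 2) powr (1 - p) * norm (f x) powr p + (1 / 2) powr (1 - p) * norm (g x) powr p"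
        using p by (intro powr_add_le) auto
      finally show "norm (norm (f x - g x) powr p)
        \<le> norm ((1 / 2) powr (1 - p) * norm (f x) powr p + (1 / 2) powr (1 - p) * norm (g x) powr p)"
        by simp
    qed
  qed (use f g in measurable)
  moreover have "norm (f x) powr p \<le> (1 - s) powr (1 - p) * norm (g x) powr p
        + s powr (1 - p) * norm (f x - g x) powr p" for x
  proof -
    have "norm (f x) \<le> norm (g x) + norm (f x - g x)"
      using norm_triangle_ineq[of "g x" "f x - g x"] by simp
    then have "norm (f x) powr p \<le> (norm (g x) + norm (f x - g x)) powr p"
      using p by (intro powr_mono2) auto
    also have "\<dots> \<le> (1 - s) powr (1 - p) * norm (g x) powr p + s powr (1 - p) * norm (f x - g x) powr p"
      using p s by (intro powr_add_le) auto
    finally show ?thesis .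
  qed
  ultimately have "(LINT x|M. norm (f x) powr p) \<le> (LINT x|M. (1 - s) powr (1 - p) * norm (g x) powr p
        + s powr (1 - p) * norm (f x - g x) powr p)"
    using f g by (intro integral_mono) auto
  then show ?thesis
    using \<open>integrable M (\<lambda>x. norm (f x - g x) powr p)\<close> g by simp
qed

text \<open>The comparison goes from \<open>u\<close> to an approximating test function, through its
  Hardy inequality, and back from its gradient to the weak gradient. Each of the two passages costs
  a factor \<open>(1 - s) powr (1 - p)\<close> and an error that vanishes in the limit.\<close>

lemma hardy_W1p_0:
  fixes u :: "real^'n::finite \<Rightarrow> real" and p R \<Lambda> :: real
  assumes p: "p > 1" and \<Lambda>: "\<Lambda> \<ge> 0" and u: "u \<in> W1p_0 p (ball 0 R)"
    and hardy: "\<And>\<phi> :: real^'n \<Rightarrow> real. \<phi> \<in> test_functions (ball 0 R) \<Longrightarrow>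
      \<Lambda> * (LINT x|lebesgue_on (ball 0 R). \<bar>\<phi> x\<bar> powr p)
      \<le> (LINT x|lebesgue_on (ball 0 R). norm (gradient \<phi> x) powr p)"
  shows "\<Lambda> * (LINT x|lebesgue_on (ball 0 R). \<bar>u x\<bar> powr p)
      \<le> (LINT x|lebesgue_on (ball 0 R). norm (weak_gradient (ball 0 R) u x) powr p)"
proof -
  let ?M = "lebesgue_on (ball (0::real^'n) R)"
  define G where "G = weak_gradient (ball 0 R) u"
  obtain \<phi> where \<phi>: "\<And>k. \<phi> k \<in> test_functions (ball 0 R)" and
    lim: "(\<lambda>k. (LINT x|?M. \<bar>\<phi> k x - u x\<bar> powr p) + (LINT x|?M. norm (gradient (\<phi> k) x - G x) powr p)) \<longlonglongrightarrow> 0"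
    using u by (auto simp: W1p_0_def G_def)
  have u_Lp: "u \<in> borel_measurable ?M" "integrable ?M (\<lambda>x. norm (u x) powr p)"
    and G_Lp: "G \<in> borel_measurable ?M" "integrable ?M (\<lambda>x. norm (G x) powr p)"
    using u by (auto simp: W1p_0_def W1p_def in_Lp_def G_def)
  define a where "a = (\<lambda>k. LINT x|?M. \<bar>\<phi> k x - u x\<bar> powr p)"
  define b where "b = (\<lambda>k. LINT x|?M. norm (gradient (\<phi> k) x - G x) powr p)"
  have ab: "a k \<ge> 0" "b k \<ge> 0" for k by (auto simp: a_def b_def)
  have ab_lim: "(\<lambda>k. a k + b k) \<longlonglongrightarrow> 0" using lim by (simp add: a_def b_def)
  have a_lim: "a \<longlonglongrightarrow> 0"
    by (rule tendsto_sandwich[OF _ _ tendsto_const ab_lim]) (use ab in auto)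
  have b_lim: "b \<longlonglongrightarrow> 0"
    by (rule tendsto_sandwich[OF _ _ tendsto_const ab_lim]) (use ab in auto)
  have \<phi>_cont: "continuous_on UNIV (\<phi> k)" for k
    using test_function_smooth(1)[OF \<phi>]
    by (intro continuous_at_imp_continuous_on ballI has_derivative_continuous) auto
  note D_cont = test_function_smooth(2)[OF \<phi>]
  have \<phi>_Lp: "\<phi> k \<in> borel_measurable ?M" "integrable ?M (\<lambda>x. norm (\<phi> k x) powr p)" for k
    using p \<phi>_cont
    by (auto intro!: continuous_integrable_ball continuous_intros continuous_on_powr'
        continuous_imp_measurable_on_sets_lebesgue intro: continuous_on_subset)
  have D_Lp: "gradient (\<phi> k) \<in> borel_measurable ?M" "integrable ?M (\<lambda>x. norm (gradient (\<phi> k) x) powr p)" for k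
    using p D_cont
    by (auto intro!: continuous_integrable_ball continuous_intros continuous_on_powr'
        continuous_imp_measurable_on_sets_lebesgue intro: continuous_on_subset)
  define U where "U = (LINT x|?M. \<bar>u x\<bar> powr p)"
  define V where "V = (LINT x|?M. norm (G x) powr p)"
  \<comment> \<open>Here \<open>s\<close> is fixed while \<open>k\<close> tends to infinity: the
    coefficient \<open>s powr (1 - p)\<close> of the errors blows up as \<open>s\<close> tends to 0,
    so the order of limits matters.\<close>
  have key: "\<Lambda> * U \<le> (1 - s) powr (1 - p) * ((1 - s) powr (1 - p) * V)" if s: "0 < s" "s < 1" for s
  proof -
    define A where "A = (1 - s) powr (1 - p)"
    define C where "C = s powr (1 - p)"
    have "\<Lambda> * U \<le> A * (A * V + C * b k) + \<Lambda> * (C * a k)" for k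
    proof -
      have "U \<le> A * (LINT x|?M. \<bar>\<phi> k x\<bar> powr p) + C * a k"
        using integral_norm_powr_le[OF p s u_Lp \<phi>_Lp[of k]]
        by (simp add: U_def A_def C_def a_def abs_minus_commute)
      then have "\<Lambda> * U \<le> \<Lambda> * (A * (LINT x|?M. \<bar>\<phi> k x\<bar> powr p) + C * a k)"
        using \<Lambda> by (intro mult_left_mono)
      also have "\<dots> = A * (\<Lambda> * (LINT x|?M. \<bar>\<phi> k x\<bar> powr p)) + \<Lambda> * (C * a k)"
        by (simp add: algebra_simps)
      also have "\<dots> \<le> A * (LINT x|?M. norm (gradient (\<phi> k) x) powr p) + \<Lambda> * (C * a k)"
        using hardy[OF \<phi>] by (intro add_right_mono mult_left_mono) (auto simp: A_def)
      also have "\<dots> \<le> A * (A * V + C * b k) + \<Lambda> * (C * a k)"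
        using integral_norm_powr_le[OF p s D_Lp[of k] G_Lp]
        by (intro add_right_mono mult_left_mono) (auto simp: A_def C_def V_def b_def)
      finally show ?thesis .
    qed
    moreover have "(\<lambda>k. A * (A * V + C * b k) + \<Lambda> * (C * a k)) \<longlonglongrightarrow> A * (A * V + C * 0) + \<Lambda> * (C * 0)"
      by (intro tendsto_intros a_lim b_lim)
    ultimately show ?thesis
      by (intro LIMSEQ_le_const[of "\<lambda>k. A * (A * V + C * b k) + \<Lambda> * (C * a k)"])
        (auto simp: A_def)
  qed
  \<comment> \<open>With the errors gone, \<open>s\<close> can tend to 0 and both extra factors tend
    to 1.\<close>
  have "((\<lambda>s. (1 - s) powr (1 - p) * ((1 - s) powr (1 - p) * V)) \<longlongrightarrow>
      (1 - 0) powr (1 - p) * ((1 - 0) powr (1 - p) * V)) (at_right 0)"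
    by (intro tendsto_intros) auto
  then have "\<Lambda> * U \<le> (1 - 0) powr (1 - p) * ((1 - 0) powr (1 - p) * V)"
  proof (rule tendsto_lowerbound)
    show "\<forall>\<^sub>F s in at_right 0. \<Lambda> * U \<le> (1 - s) powr (1 - p) * ((1 - s) powr (1 - p) * V)"
      using eventually_at_right_less[of 0] order_tendstoD(2)[OF tendsto_ident_at, of 0 1]
      unfolding eventually_at_right_field by (intro exI[of _ 1]) (use key in auto)
  qed auto
  then show ?thesis by (simp add: U_def V_def G_def)
qed

text \<open>The inequality extends to \<open>W1p_0\<close>, and dividing by the integral of
  \<open>\<bar>u\<bar> powr p\<close>, positive since \<open>u\<close> is not zero almost
  everywhere, bounds each Rayleigh quotient.\<close>

lemma first_eigenvalue_ball_ge:
  fixes p R \<Lambda> :: real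
  assumes p: "p > 1" and \<Lambda>: "\<Lambda> \<ge> 0"
    and hardy: "\<And>\<phi> :: real^'n::finite \<Rightarrow> real. \<phi> \<in> test_functions (ball 0 R) \<Longrightarrow>
      \<Lambda> * (LINT x|lebesgue_on (ball 0 R). \<bar>\<phi> x\<bar> powr p)
      \<le> (LINT x|lebesgue_on (ball 0 R). norm (gradient \<phi> x) powr p)"
  shows "first_eigenvalue p (ball (0 :: real^'n) R) \<ge> ereal \<Lambda>"
  unfolding first_eigenvalue_def
proof (rule INF_greatest)
  let ?M = "lebesgue_on (ball (0::real^'n) R)"
  fix u assume "u \<in> {u \<in> W1p_0 p (ball (0 :: real^'n) R). \<not> (AE x in ?M. u x = 0)}"
  then have u: "u \<in> W1p_0 p (ball 0 R)" and nz: "\<not> (AE x in ?M. u x = 0)"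
    by auto
  have int: "integrable ?M (\<lambda>x. \<bar>u x\<bar> powr p)"
    using u by (auto simp: W1p_0_def W1p_def in_Lp_def)
  have "(LINT x|?M. \<bar>u x\<bar> powr p) \<noteq> 0"
    using nz p by (subst integral_nonneg_eq_0_iff_AE[OF int]) auto
  moreover have "(LINT x|?M. \<bar>u x\<bar> powr p) \<ge> 0" by simp
  ultimately have "(LINT x|?M. \<bar>u x\<bar> powr p) > 0" by linarith
  then show "ereal \<Lambda> \<le> ereal ((LINT x|?M. norm (weak_gradient (ball 0 R) u x) powr p) /
             (LINT x|?M. \<bar>u x\<bar> powr p))"
    using hardy_W1p_0[OF p \<Lambda> u hardy] by (simp add: le_divide_eq)
qed

subsection \<open>The radial potential\<close>

text \<open>The critical point solves \<open>k * t powr (k - 1) = 1\<close>, that is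
  \<open>t = a\<close>, and the value there is \<open>a / k\<close>. The substitution
  \<open>t = a * s\<close> moves it to 1, where the tangent inequality for \<open>s powr k\<close>
  gives the bound; its direction and the sign of \<open>k - 1\<close> change together.\<close>

lemma diff_powr_divide_le:
  fixes k t :: real
  assumes "k > 0" "k \<noteq> 1" "t > 0"
  shows "(t - t powr k) / (k - 1) \<le> k powr (- (k / (k - 1)))"
proof -
  define a where "a = k powr (- (1 / (k - 1)))"
  define s where "s = t / a"
  have a: "a > 0" using assms by (simp add: a_def)
  have ak: "a powr k = a / k"
  proof -
    have "a powr k = a powr (1 + (k - 1))" by simp
    also have "\<dots> = a * a powr (k - 1)" using a by (simp only: powr_add powr_one)
    also have "a powr (k - 1) = k powr (- (1 / (k - 1)) * (k - 1))"
      unfolding a_def by (rule powr_powr)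
    also have "\<dots> = 1 / k"
      using assms by (simp add: powr_minus divide_inverse)
    finally show ?thesis by simp
  qed
  have a_div: "a / k = k powr (- (k / (k - 1)))"
  proof -
    have "- (k / (k - 1)) = - (1 / (k - 1)) + - 1"
      using assms by (simp add: field_simps)
    then have "k powr (- (k / (k - 1))) = a * k powr (- 1)"
      unfolding a_def by (simp only: powr_add)
    then show ?thesis using assms by (simp add: powr_minus divide_inverse)
  qed
  have t: "t = a * s" "s > 0" using a assms by (auto simp: s_def)
  have "t - t powr k = a * (s - s powr k / k)"
    unfolding t(1) using a by (simp add: powr_mult ak algebra_simps)
  moreover have "(s - s powr k / k) / (k - 1) \<le> 1 / k"
  proof (cases "k > 1")
    case True
    then have "s powr k \<ge> 1 + k * (s - 1)" using t by (intro powr_ge_tangent) auto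
    then have "s - s powr k / k \<le> (k - 1) / k"
      using divide_right_mono[of "1 + k * (s - 1)" "s powr k" k] assms
      by (simp add: diff_divide_distrib add_divide_distrib right_diff_distrib)
    then have "(s - s powr k / k) / (k - 1) \<le> (k - 1) / k / (k - 1)"
      using True by (intro divide_right_mono) auto
    then show ?thesis using True by simp
  next
    case False
    then have "s powr k \<le> 1 + k * (s - 1)" using t assms by (intro powr_le_tangent) auto
    then have "s - s powr k / k \<ge> (k - 1) / k"
      using divide_right_mono[of "s powr k" "1 + k * (s - 1)" k] assms
      by (simp add: diff_divide_distrib add_divide_distrib right_diff_distrib)
    then have "(s - s powr k / k) / (k - 1) \<le> (k - 1) / k / (k - 1)"
      using False by (intro divide_right_mono_neg) auto
    then show ?thesis using assms by simp
  qed
  ultimately have "(t - t powr k) / (k - 1) \<le> a * (1 / k)"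
    using a by (metis mult_left_mono less_imp_le times_divide_eq_right)
  then show ?thesis using a_div by simp
qed

text \<open>The integral of \<open>s powr (- k)\<close> from \<open>r\<close> to \<open>R\<close>;
  the logarithm replaces the power formula where the latter would divide by zero.\<close>

definition radial_potential :: "real \<Rightarrow> real \<Rightarrow> real \<Rightarrow> real" where
  "radial_potential R k r =
    (if k = 1 then ln (R / r) else (R powr (1 - k) - r powr (1 - k)) / (1 - k))"

lemma radial_potential_measurable [measurable]: "radial_potential R k \<in> borel_measurable borel"
  unfolding radial_potential_def[abs_def] by measurable

lemma radial_potential_deriv:
  assumes "0 < r" "0 < R"
  shows "(radial_potential R k has_real_derivative - (r powr - k)) (at r)"
proof (cases "k = 1")
  case True
  have "((\<lambda>r. ln (R / r)) has_real_derivative - (r powr - k)) (at r)"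
    using assms True by (auto intro!: derivative_eq_intros simp: powr_minus divide_simps)
  then show ?thesis using True by (simp add: radial_potential_def[abs_def])
next
  case False
  have "((\<lambda>r. (R powr (1 - k) - r powr (1 - k)) / (1 - k)) has_real_derivative - (r powr - k)) (at r)"
    using assms False by (auto intro!: derivative_eq_intros simp: divide_simps)
  then show ?thesis using False by (simp add: radial_potential_def[abs_def])
qed

lemma radial_potential_pos:
  assumes "0 < r" "r < R"
  shows "radial_potential R k r > 0"
proof (cases "k < 1")
  case True
  then have "r powr (1 - k) < R powr (1 - k)"
    using assms by (intro powr_less_mono2) auto
  then show ?thesis using True by (simp add: radial_potential_def)
next
  case False
  then show ?thesis using assms powr_less_mono2_neg[of "1 - k" r R]
    by (auto simp: radial_potential_def divide_neg_neg)
qed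

text \<open>For \<open>k = 1\<close>, \<open>ln x \<le> x - 1\<close> is used at
  \<open>x = R / (r * exp 1)\<close>, with equality at the maximum point \<open>r = R / e\<close>.
  Otherwise the product is homogeneous of degree 1 in \<open>(r, R)\<close>, so
  \<open>r = R * t\<close> reduces it to one variable.\<close>

lemma radial_potential_bound:
  assumes "0 < r" "0 < R" "k > 0"
  shows "r powr k * radial_potential R k r
      \<le> R * (if k = 1 then exp (- 1) else k powr (- (k / (k - 1))))"
proof (cases "k = 1")
  case True
  have "ln (R / (r * exp 1)) \<le> R / (r * exp 1) - 1"
    using assms by (intro ln_le_minus_one) auto
  then have "ln (R / r) \<le> R / (r * exp 1)"
    using assms by (simp add: ln_div ln_mult)
  then have "r * ln (R / r) \<le> r * (R / (r * exp 1))"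
    using assms by (intro mult_left_mono) auto
  also have "r * (R / (r * exp 1)) = R * exp (- 1)"
    using assms by (simp add: exp_minus divide_inverse)
  finally show ?thesis using True assms by (simp add: radial_potential_def)
next
  case False
  define t where "t = r / R"
  have t: "r = R * t" "t > 0" using assms by (auto simp: t_def)
  have R1: "R powr k * R powr (1 - k) = R" and t1: "t powr k * t powr (1 - k) = t"
    using assms t by (simp_all flip: powr_add)
  have "r powr k * (R powr (1 - k) - r powr (1 - k))
      = (R powr k * R powr (1 - k)) * (t powr k) - (R powr k * R powr (1 - k)) * (t powr k * t powr (1 - k))"
    unfolding t(1) by (simp add: powr_mult algebra_simps)
  then have "r powr k * (R powr (1 - k) - r powr (1 - k)) = R * (t powr k - t)"
    unfolding R1 t1 by (simp add: algebra_simps)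
  then have "r powr k * radial_potential R k r = R * ((t powr k - t) / (1 - k))"
    using False by (simp add: radial_potential_def)
  also have "(t powr k - t) / (1 - k) = (t - t powr k) / (k - 1)"
    using minus_divide_divide[of "t powr k - t" "1 - k"] by simp
  also have "R * \<dots> \<le> R * k powr (- (k / (k - 1)))"
    using assms t False by (intro mult_left_mono diff_powr_divide_le) auto
  finally show ?thesis using False by simp
qed

section \<open>The explicit constant and the two cases of the theorem\<close>

lemma first_eigenvalue_ball_ge_explicit:
  fixes p R :: real
  defines "k \<equiv> (real CARD('n::finite) - 1) / (p - 1)"
  assumes n: "CARD('n) \<ge> 2" and p: "p > 1" and R: "R > 0"
  shows "first_eigenvalue p (ball (0 :: real^'n) R) \<ge>
    ereal (((p - 1) / (p * (R * (if k = 1 then exp (- 1) else k powr (- (k / (k - 1))))))) powr p)"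
proof (intro first_eigenvalue_ball_ge p hardy_test_function[where \<rho> = "radial_potential R k"] R)
  have k: "k > 0" using n p by (simp add: k_def)
  show "0 < radial_potential R k r \<and> r powr ((real CARD('n) - 1) / (p - 1)) * radial_potential R k r
      \<le> R * (if k = 1 then exp (- 1) else k powr (- (k / (k - 1))))" if "0 < r" "r < R" for r
    using radial_potential_pos[OF that, of k] radial_potential_bound[OF that(1) R k]
    unfolding k_def by blast
  show "(radial_potential R k has_real_derivative - (r powr - ((real CARD('n) - 1) / (p - 1)))) (at r)"
    if "0 < r" for r
    using radial_potential_deriv[OF that R, of k] by (simp add: k_def)
qed auto

theorem theorem6p2:
  fixes p R :: real
  assumes "CARD('n::finite) \<ge> 2" and "p > 1" and "R > 0"
  shows "(p \<noteq> real CARD('n) \<longrightarrow>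
      first_eigenvalue p (ball (0 :: real^'n) R) \<ge>
        ereal ((1 / (p * R)) powr p *
          ((real CARD('n) - 1) ^ (CARD('n) - 1) / (p - 1) powr (p - 1))
            powr (p / (real CARD('n) - p)))) \<and>
    (p = real CARD('n) \<longrightarrow>
      first_eigenvalue (real CARD('n)) (ball (0 :: real^'n) R) \<ge>
        ereal (((real CARD('n) - 1) / (real CARD('n) * R)) ^ CARD('n) * exp (real CARD('n))))"
proof (intro conjI impI)
  define n where "n = real CARD('n)"
  have n: "n > 1" using assms by (simp add: n_def)
  define k where "k = (n - 1) / (p - 1)"
  have bound: "ereal (((p - 1) / (p * (R * (if k = 1 then exp (- 1) else k powr (- (k / (k - 1))))))) powr p)
      \<le> first_eigenvalue p (ball (0 :: real^'n) R)"
    unfolding k_def n_def by (rule first_eigenvalue_ball_ge_explicit[OF assms])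
  {
    assume "p \<noteq> real CARD('n)"
    then have pn: "p \<noteq> n" by (simp add: n_def)
    have k: "k \<noteq> 1" using pn assms by (simp add: k_def field_simps)
    have kk: "k / (k - 1) = (n - 1) / (n - p)"
    proof -
      have "k - 1 = (n - p) / (p - 1)" using assms by (simp add: k_def field_simps)
      then show ?thesis using assms by (simp add: k_def)
    qed
    have pw: "(n - 1) powr (n - 1) = (n - 1) ^ (CARD('n) - 1)"
    proof -
      have "n - 1 = real (CARD('n) - 1)" using assms by (simp add: n_def of_nat_diff)
      then show ?thesis using n by (metis powr_realpow diff_gt_0_iff_gt)
    qed
    \<comment> \<open>The exponents \<open>e\<close> and \<open>e - 1\<close> of
      \<open>n - 1\<close> and \<open>p - 1\<close> share the denominator \<open>n - p\<close>, so
      \<open>1 / (n - p)\<close> can be taken out as a common exponent.\<close>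
    define e where "e = (n - 1) / (n - p)"
    have e1: "e - 1 = (p - 1) / (n - p)" using pn by (simp add: e_def field_simps)
    have "(p - 1) / (p * (R * k powr (- (k / (k - 1))))) = (1 / (p * R)) * ((p - 1) * k powr e)"
      unfolding kk e_def[symmetric] by (simp add: powr_minus divide_inverse)
    also have "(p - 1) * k powr e = (n - 1) powr e / (p - 1) powr (e - 1)"
      using assms n by (simp add: k_def powr_divide powr_diff)
    also have "\<dots> = ((n - 1) powr (n - 1) / (p - 1) powr (p - 1)) powr (1 / (n - p))"
      unfolding e1 by (simp add: powr_divide powr_powr e_def)
    finally have eq: "(p - 1) / (p * (R * k powr (- (k / (k - 1)))))
        = (1 / (p * R)) * ((n - 1) powr (n - 1) / (p - 1) powr (p - 1)) powr (1 / (n - p))" .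
    have "((p - 1) / (p * (R * k powr (- (k / (k - 1)))))) powr p
        = (1 / (p * R)) powr p * ((n - 1) ^ (CARD('n) - 1) / (p - 1) powr (p - 1)) powr (p / (n - p))"
      unfolding eq powr_mult powr_powr pw by simp
    then show "first_eigenvalue p (ball (0 :: real^'n) R) \<ge>
        ereal ((1 / (p * R)) powr p *
          ((real CARD('n) - 1) ^ (CARD('n) - 1) / (p - 1) powr (p - 1))
            powr (p / (real CARD('n) - p)))"
      using bound k by (simp add: n_def)
  next
    assume p: "p = real CARD('n)"
    then have "k = 1" using n by (simp add: k_def n_def)
    \<comment> \<open>For \<open>p = n\<close> the exponent \<open>k\<close> is 1, and the bound
      \<open>R / e\<close> puts a factor \<open>exp 1\<close> into the base; its \<open>n\<close>-th
      power is the exponential in the claim.\<close>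
    have "(p - 1) / (p * (R * exp (- 1))) = (n - 1) / (n * R) * exp 1"
      by (simp add: p n_def exp_minus divide_inverse)
    then have "((p - 1) / (p * (R * exp (- 1)))) powr p = ((n - 1) / (n * R) * exp 1) powr real CARD('n)"
      by (simp add: p)
    also have "\<dots> = ((n - 1) / (n * R) * exp 1) ^ CARD('n)"
      using n assms by (intro powr_realpow mult_pos_pos divide_pos_pos) auto
    also have "\<dots> = ((n - 1) / (n * R)) ^ CARD('n) * exp (real CARD('n))"
      unfolding power_mult_distrib by (simp flip: exp_of_nat_mult)
    finally show "first_eigenvalue (real CARD('n)) (ball (0 :: real^'n) R) \<ge>
        ereal (((real CARD('n) - 1) / (real CARD('n) * R)) ^ CARD('n) * exp (real CARD('n)))"
      using bound \<open>k = 1\<close> by (simp add: n_def p)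
  }
qed

end
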